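(* Let $\mathbf C$ be a transitive topological clone, and let $\xi$ be a clone isomorphism from $\mathbf C$ onto a topological clone $\mathbf C'$. If the restriction of $\xi$ to the unary part, $\xi\colon\mathbf C^{(1)}\to\mathbf C'^{(1)}$, is open, then $\xi$ is open.
   Context: An (abstract) clone is a multi-sorted structure with sorts $C^{(n)}$, $n\ge1$ (the $n$-ary elements), constants $\pi^n_k\in C^{(n)}$ for $1\le k\le n$, and operations $\operatorname{comp}^n_m\colon C^{(n)}\times (C^{(m)})^n\to C^{(m)}$, written $f(g_1,\dots,g_n)$, satisfying $f(\pi^n_1,\dots,\pi^n_n)=f$, $\pi^n_k(f_1,\dots,f_n)=f_k$, and $f(g_1(h_1,\dots,h_m),\dots,g_n(h_1,\dots,h_m))=(f(g_1,\dots,g_n))(h_1,\dots,h_m)$. Clone homomorphisms preserve sorts, the constants $\pi^n_k$ and the operations $\operatorname{comp}^n_m$; isomorphisms are bijective homomorphisms. A topological clone $\mathbf C$ is a clone with a topology on $\bigcup_{n\ge1}C^{(n)}$ such that each $C^{(n)}$ is clopen and all composition operations are continuous; $\mathbf C^{(n)}$ denotes its $n$-ary part. A function clone on a set $D$ is a set of operations $D^n\to D$ ($n\ge1$) containing all projections and closed under composition; with the topology of pointwise convergence ($D$ discrete; for each $n$ the $n$-ary part is clopen) it induces a topological clone. A function clone is transitive if the permutation group of its invertible unary functions (those having a two-sided inverse in the clone) acts transitively on the domain. A topological clone is transitive if it is (isomorphic, via a clone isomorphism that is a homeomorphism, to) the topological clone of a transitive function clone. *)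

theory Defs
  imports "HOL-Analysis.Analysis"
begin

text \<open>
  Tuples of length \<open>n\<close> over a set \<open>S\<close> are the extensional functions \<open>{1..n} \<rightarrow>\<^sub>E S\<close>. Only the sorts with
  index \<open>n \<ge> 1\<close> are part of the structure; the field values at index \<open>0\<close> are irrelevant.
\<close>

record 'a clone_sig =
  cl_sort :: "nat \<Rightarrow> 'a set"
  cl_proj :: "nat \<Rightarrow> nat \<Rightarrow> 'a"
  cl_comp :: "nat \<Rightarrow> nat \<Rightarrow> 'a \<Rightarrow> (nat \<Rightarrow> 'a) \<Rightarrow> 'a"

record 'a topclone_sig = "'a clone_sig" +
  cl_top :: "'a topology"

definition cl_elems :: "('a, 'm) clone_sig_scheme \<Rightarrow> 'a set" where
  "cl_elems C = (\<Union>n\<in>{1..}. cl_sort C n)"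

text \<open>
  \<open>cl_comp C n m f g\<close> is \<open>f(g\<^sub>1, \<dots>, g\<^sub>n)\<close> for \<open>f\<close> of sort \<open>n\<close> and \<open>g\<^sub>1, \<dots>, g\<^sub>n\<close> of sort \<open>m\<close>.
  As all sorts live in one type, the disjointness of distinct sorts is stated explicitly.
\<close>

locale clone =
  fixes C :: "('a, 'm) clone_sig_scheme"
  assumes sorts_disjoint: "disjoint_family_on (cl_sort C) {1..}"
    and proj_closed: "\<And>n k. 1 \<le> k \<Longrightarrow> k \<le> n \<Longrightarrow> cl_proj C n k \<in> cl_sort C n"
    and comp_closed: "\<And>n m f g. 1 \<le> n \<Longrightarrow> 1 \<le> m \<Longrightarrow> f \<in> cl_sort C n \<Longrightarrow>
      g \<in> {1..n} \<rightarrow>\<^sub>E cl_sort C m \<Longrightarrow> cl_comp C n m f g \<in> cl_sort C m"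
    and comp_proj_right: "\<And>n f. 1 \<le> n \<Longrightarrow> f \<in> cl_sort C n \<Longrightarrow>
      cl_comp C n n f (\<lambda>k\<in>{1..n}. cl_proj C n k) = f"
    and comp_proj_left: "\<And>n m k f. 1 \<le> m \<Longrightarrow> 1 \<le> k \<Longrightarrow> k \<le> n \<Longrightarrow>
      f \<in> {1..n} \<rightarrow>\<^sub>E cl_sort C m \<Longrightarrow> cl_comp C n m (cl_proj C n k) f = f k"
    and comp_assoc: "\<And>n m p f g h. 1 \<le> n \<Longrightarrow> 1 \<le> m \<Longrightarrow> 1 \<le> p \<Longrightarrow> f \<in> cl_sort C n \<Longrightarrow>
      g \<in> {1..n} \<rightarrow>\<^sub>E cl_sort C m \<Longrightarrow> h \<in> {1..m} \<rightarrow>\<^sub>E cl_sort C p \<Longrightarrow>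
      cl_comp C n p f (\<lambda>i\<in>{1..n}. cl_comp C m p (g i) h) = cl_comp C m p (cl_comp C n m f g) h"

definition clone_hom ::
    "('a, 'm) clone_sig_scheme \<Rightarrow> ('b, 'k) clone_sig_scheme \<Rightarrow> ('a \<Rightarrow> 'b) \<Rightarrow> bool" where
  "clone_hom C C' \<xi> \<longleftrightarrow>
    (\<forall>n\<ge>1. \<forall>f\<in>cl_sort C n. \<xi> f \<in> cl_sort C' n) \<and>
    (\<forall>n k. 1 \<le> k \<and> k \<le> n \<longrightarrow> \<xi> (cl_proj C n k) = cl_proj C' n k) \<and>
    (\<forall>n\<ge>1. \<forall>m\<ge>1. \<forall>f\<in>cl_sort C n. \<forall>g\<in>{1..n} \<rightarrow>\<^sub>E cl_sort C m.
      \<xi> (cl_comp C n m f g) = cl_comp C' n m (\<xi> f) (\<lambda>i\<in>{1..n}. \<xi> (g i)))"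

definition clone_iso ::
    "('a, 'm) clone_sig_scheme \<Rightarrow> ('b, 'k) clone_sig_scheme \<Rightarrow> ('a \<Rightarrow> 'b) \<Rightarrow> bool" where
  "clone_iso C C' \<xi> \<longleftrightarrow> clone_hom C C' \<xi> \<and> bij_betw \<xi> (cl_elems C) (cl_elems C')"

definition cl_part :: "('a, 'm) topclone_sig_scheme \<Rightarrow> nat \<Rightarrow> 'a topology" where
  "cl_part C n = subtopology (cl_top C) (cl_sort C n)"

locale topological_clone = clone C for C :: "('a, 'm) topclone_sig_scheme" +
  assumes topspace_top: "topspace (cl_top C) = cl_elems C"
    and sort_open: "\<And>n. 1 \<le> n \<Longrightarrow> openin (cl_top C) (cl_sort C n)"
    and sort_closed: "\<And>n. 1 \<le> n \<Longrightarrow> closedin (cl_top C) (cl_sort C n)"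
    and comp_continuous: "\<And>n m. 1 \<le> n \<Longrightarrow> 1 \<le> m \<Longrightarrow>
      continuous_map (prod_topology (cl_part C n) (product_topology (\<lambda>_. cl_part C m) {1..n}))
        (cl_part C m) (\<lambda>(f, g). cl_comp C n m f g)"

definition op_proj :: "'d set \<Rightarrow> nat \<Rightarrow> nat \<Rightarrow> (nat \<Rightarrow> 'd) \<Rightarrow> 'd" where
  "op_proj D n k = (\<lambda>x\<in>{1..n} \<rightarrow>\<^sub>E D. x k)"

definition op_comp :: "'d set \<Rightarrow> nat \<Rightarrow> nat \<Rightarrow> ((nat \<Rightarrow> 'd) \<Rightarrow> 'd) \<Rightarrow> (nat \<Rightarrow> (nat \<Rightarrow> 'd) \<Rightarrow> 'd)
    \<Rightarrow> (nat \<Rightarrow> 'd) \<Rightarrow> 'd" where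
  "op_comp D n m f g = (\<lambda>x\<in>{1..m} \<rightarrow>\<^sub>E D. f (\<lambda>i\<in>{1..n}. g i x))"

text \<open>A function clone on \<open>D\<close> is given by the sets \<open>F n\<close> of its \<open>n\<close>-ary members, \<open>n \<ge> 1\<close>.\<close>

locale function_clone =
  fixes D :: "'d set" and F :: "nat \<Rightarrow> ((nat \<Rightarrow> 'd) \<Rightarrow> 'd) set"
  assumes ops: "\<And>n. 1 \<le> n \<Longrightarrow> F n \<subseteq> ({1..n} \<rightarrow>\<^sub>E D) \<rightarrow>\<^sub>E D"
    and op_proj_mem: "\<And>n k. 1 \<le> k \<Longrightarrow> k \<le> n \<Longrightarrow> op_proj D n k \<in> F n"
    and op_comp_mem: "\<And>n m f g. 1 \<le> n \<Longrightarrow> 1 \<le> m \<Longrightarrow> f \<in> F n \<Longrightarrow> g \<in> {1..n} \<rightarrow>\<^sub>E F m \<Longrightarrow>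
      op_comp D n m f g \<in> F m"

text \<open>
  An operation is tagged with its arity, so that operations of different arities are distinct; the
  topology is the disjoint sum over the arities of the topologies of pointwise convergence.
\<close>

definition topclone_of :: "'d set \<Rightarrow> (nat \<Rightarrow> ((nat \<Rightarrow> 'd) \<Rightarrow> 'd) set) \<Rightarrow>
    (nat \<times> ((nat \<Rightarrow> 'd) \<Rightarrow> 'd)) topclone_sig" where
  "topclone_of D F =
    \<lparr> cl_sort = (\<lambda>n. {n} \<times> F n),
      cl_proj = (\<lambda>n k. (n, op_proj D n k)),
      cl_comp = (\<lambda>n m f g. (m, op_comp D n m (snd f) (\<lambda>i\<in>{1..n}. snd (g i)))),
      cl_top = sum_topology (\<lambda>n. subtopology
        (product_topology (\<lambda>_. discrete_topology D) ({1..n} \<rightarrow>\<^sub>E D)) (F n)) {1..} \<rparr>"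

definition invertible_unary :: "'d set \<Rightarrow> (nat \<Rightarrow> ((nat \<Rightarrow> 'd) \<Rightarrow> 'd) set) \<Rightarrow>
    ((nat \<Rightarrow> 'd) \<Rightarrow> 'd) set" where
  "invertible_unary D F = {f \<in> F 1. \<exists>g\<in>F 1.
    op_comp D 1 1 f (\<lambda>i\<in>{1..1}. g) = op_proj D 1 1 \<and>
    op_comp D 1 1 g (\<lambda>i\<in>{1..1}. f) = op_proj D 1 1}"

definition transitive_function_clone :: "'d set \<Rightarrow> (nat \<Rightarrow> ((nat \<Rightarrow> 'd) \<Rightarrow> 'd) set) \<Rightarrow> bool" where
  "transitive_function_clone D F \<longleftrightarrow> function_clone D F \<and>
    (\<forall>x\<in>D. \<forall>y\<in>D. \<exists>f\<in>invertible_unary D F. f (\<lambda>i\<in>{1..1}. x) = y)"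

text \<open>
  The type argument fixes the type in which the domain of the function clone lives, since HOL cannot
  quantify over types inside a definition; the domain itself is an arbitrary set of that type.
\<close>

definition transitive_topological_clone ::
    "'d itself \<Rightarrow> ('a, 'm) topclone_sig_scheme \<Rightarrow> bool" where
  "transitive_topological_clone (_ :: 'd itself) C \<longleftrightarrow> topological_clone C \<and>
    (\<exists>(D :: 'd set) F \<phi>. transitive_function_clone D F \<and> clone_iso C (topclone_of D F) \<phi> \<and>
      homeomorphic_map (cl_top C) (cl_top (topclone_of D F)) \<phi>)"

end

theory Submission
  imports Defs
begin

text \<open>
  In a transitive function clone the topology of every sort is determined by the unary part. The
  topology of pointwise convergence on the \<open>n\<close>-ary operations is generated by the conditions
  \<open>f(a\<^sub>1, \<dots>, a\<^sub>n) = b\<close>. Transitivity supplies unary members \<open>\<alpha>\<^sub>1, \<dots>, \<alpha>\<^sub>n\<close> that all start from one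
  point \<open>c\<close> and satisfy \<open>\<alpha>\<^sub>i(c) = a\<^sub>i\<close>, so such a condition says that the unary operation
  \<open>f(\<alpha>\<^sub>1, \<dots>, \<alpha>\<^sub>n)\<close> lies in the open set \<open>W\<close> of unary members sending \<open>c\<close> to \<open>b\<close>. The topology of
  sort \<open>n\<close> is therefore generated by preimages of open sets of unary elements under the maps
  \<open>f \<mapsto> f(\<alpha>\<^sub>1, \<dots>, \<alpha>\<^sub>n)\<close> (lemma \<open>transitive_clone_unary_basis\<close>).

  A clone isomorphism \<open>\<xi>\<close> takes the preimage of \<open>W\<close> under \<open>f \<mapsto> f(\<alpha>\<^sub>1, \<dots>, \<alpha>\<^sub>n)\<close> to the preimage of
  \<open>\<xi>(W)\<close> under \<open>f' \<mapsto> f'(\<xi>(\<alpha>\<^sub>1), \<dots>, \<xi>(\<alpha>\<^sub>n))\<close>. If \<open>\<xi>\<close> is open on the unary part, then \<open>\<xi>(W)\<close> is open,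
  and the latter preimage is open because composition in the target is continuous (lemma
  \<open>clone_iso_image_unary_preimage_open\<close>).
\<close>

section \<open>Clone isomorphisms and sorts\<close>

text \<open>
  A homomorphism preserves sorts; that it also reflects them comes from the disjointness of the
  sorts of its target, as an element of another sort would have its image in that other sort.
\<close>

lemma clone_iso_reflects_sort:
  assumes "clone_iso C C' \<xi>" "disjoint_family_on (cl_sort C') {1..}"
    and "x \<in> cl_elems C" "\<xi> x \<in> cl_sort C' n" "1 \<le> n"
  shows "x \<in> cl_sort C n"
proof -
  obtain m where m: "1 \<le> m" "x \<in> cl_sort C m"
    using assms(3) by (auto simp: cl_elems_def)
  then have "\<xi> x \<in> cl_sort C' m"
    using assms(1) by (auto simp: clone_iso_def clone_hom_def)
  then have "m = n"
    using assms(2,4,5) m(1) by (auto simp: disjoint_family_on_def)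
  with m show ?thesis by simp
qed

lemma clone_iso_surj_on_sort:
  assumes "clone_iso C C' \<xi>" "disjoint_family_on (cl_sort C') {1..}"
    and "y \<in> cl_sort C' n" "1 \<le> n"
  obtains x where "x \<in> cl_sort C n" "\<xi> x = y"
proof -
  have "y \<in> cl_elems C'"
    using assms(3,4) by (auto simp: cl_elems_def)
  then obtain x where x: "x \<in> cl_elems C" "\<xi> x = y"
    using assms(1) by (metis clone_iso_def bij_betw_imp_surj_on imageE)
  then have "x \<in> cl_sort C n"
    using clone_iso_reflects_sort[OF assms(1,2)] assms(3,4) by simp
  with x(2) show ?thesis by (rule that[rotated])
qed

section \<open>Preimages of sets of unary elements under composition\<close>

definition unary_preimage ::
    "('a, 'm) clone_sig_scheme \<Rightarrow> nat \<Rightarrow> (nat \<Rightarrow> 'a) \<Rightarrow> 'a set \<Rightarrow> 'a set" where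
  "unary_preimage C n \<alpha> W = {x \<in> cl_sort C n. cl_comp C n 1 x \<alpha> \<in> W}"

lemma (in topological_clone) topspace_cl_part:
  assumes "1 \<le> n"
  shows "topspace (cl_part C n) = cl_sort C n"
  using assms by (auto simp: cl_part_def topspace_top cl_elems_def)

lemma (in topological_clone) unary_preimage_open:
  assumes n: "1 \<le> n" and \<alpha>: "\<alpha> \<in> {1..n} \<rightarrow>\<^sub>E cl_sort C 1" and W: "openin (cl_part C 1) W"
  shows "openin (cl_top C) (unary_preimage C n \<alpha> W)"
proof -
  have "continuous_map (cl_part C n)
      (prod_topology (cl_part C n) (product_topology (\<lambda>_. cl_part C 1) {1..n})) (\<lambda>x. (x, \<alpha>))"
    using \<alpha> by (intro continuous_map_pairedI) (auto simp: topspace_cl_part)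
  from continuous_map_compose[OF this comp_continuous[OF n]]
  have "continuous_map (cl_part C n) (cl_part C 1) (\<lambda>x. cl_comp C n 1 x \<alpha>)"
    by (simp add: o_def)
  from openin_continuous_map_preimage[OF this W]
  have "openin (cl_part C n) (unary_preimage C n \<alpha> W)"
    using n by (simp add: unary_preimage_def topspace_cl_part)
  then show ?thesis
    using sort_open[OF n] by (simp add: cl_part_def openin_open_subtopology)
qed

text \<open>
  Equality needs bijectivity in two ways: injectivity makes membership in \<open>\<xi>(W)\<close> equivalent to
  membership in \<open>W\<close>, and surjectivity makes every \<open>n\<close>-ary element of the target an image.
\<close>

lemma clone_iso_image_unary_preimage:
  assumes iso: "clone_iso C C' \<xi>" and C: "clone C" and disj: "disjoint_family_on (cl_sort C') {1..}"
    and n: "1 \<le> n" and \<alpha>: "\<alpha> \<in> {1..n} \<rightarrow>\<^sub>E cl_sort C 1" and W: "W \<subseteq> cl_sort C 1"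
  shows "\<xi> ` unary_preimage C n \<alpha> W = unary_preimage C' n (\<lambda>i\<in>{1..n}. \<xi> (\<alpha> i)) (\<xi> ` W)"
proof -
  have hom: "\<xi> x \<in> cl_sort C' n"
      "\<xi> (cl_comp C n 1 x \<alpha>) = cl_comp C' n 1 (\<xi> x) (\<lambda>i\<in>{1..n}. \<xi> (\<alpha> i))"
    if "x \<in> cl_sort C n" for x
    using iso n \<alpha> that unfolding clone_iso_def clone_hom_def by auto
  have inj: "inj_on \<xi> (cl_elems C)"
    using iso by (simp add: clone_iso_def bij_betw_def)
  have comp_mem: "cl_comp C n 1 x \<alpha> \<in> cl_elems C" if "x \<in> cl_sort C n" for x
    using clone.comp_closed[OF C n _ that \<alpha>] by (auto simp: cl_elems_def)
  have W': "W \<subseteq> cl_elems C"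
    using W by (auto simp: cl_elems_def)
  have iff: "cl_comp C' n 1 (\<xi> x) (\<lambda>i\<in>{1..n}. \<xi> (\<alpha> i)) \<in> \<xi> ` W \<longleftrightarrow> cl_comp C n 1 x \<alpha> \<in> W"
    if "x \<in> cl_sort C n" for x
    using inj_on_image_mem_iff[OF inj comp_mem[OF that] W'] hom(2)[OF that] by simp
  show ?thesis
  proof (intro equalityI subsetI)
    fix y assume "y \<in> unary_preimage C' n (\<lambda>i\<in>{1..n}. \<xi> (\<alpha> i)) (\<xi> ` W)"
    then have y: "y \<in> cl_sort C' n" "cl_comp C' n 1 y (\<lambda>i\<in>{1..n}. \<xi> (\<alpha> i)) \<in> \<xi> ` W"
      by (auto simp: unary_preimage_def)
    obtain x where x: "x \<in> cl_sort C n" "\<xi> x = y"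
      using clone_iso_surj_on_sort[OF iso disj y(1) n] .
    with y iff show "y \<in> \<xi> ` unary_preimage C n \<alpha> W"
      by (auto simp: unary_preimage_def)
  next
    fix y assume "y \<in> \<xi> ` unary_preimage C n \<alpha> W"
    then obtain x where x: "x \<in> cl_sort C n" "cl_comp C n 1 x \<alpha> \<in> W" "y = \<xi> x"
      by (auto simp: unary_preimage_def)
    then show "y \<in> unary_preimage C' n (\<lambda>i\<in>{1..n}. \<xi> (\<alpha> i)) (\<xi> ` W)"
      unfolding unary_preimage_def using hom(1)[OF x(1)] iff[OF x(1)] by blast
  qed
qed

lemma clone_iso_image_unary_preimage_open:
  assumes iso: "clone_iso C C' \<xi>" and C: "topological_clone C" and C': "topological_clone C'"
    and om: "open_map (cl_part C 1) (cl_part C' 1) \<xi>"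
    and n: "1 \<le> n" and \<alpha>: "\<alpha> \<in> {1..n} \<rightarrow>\<^sub>E cl_sort C 1" and W: "openin (cl_part C 1) W"
  shows "openin (cl_top C') (\<xi> ` unary_preimage C n \<alpha> W)"
proof -
  interpret C: topological_clone C by fact
  interpret C': topological_clone C' by fact
  have "W \<subseteq> cl_sort C 1"
    using openin_subset[OF W] by (simp add: C.topspace_cl_part)
  then have eq: "\<xi> ` unary_preimage C n \<alpha> W = unary_preimage C' n (\<lambda>i\<in>{1..n}. \<xi> (\<alpha> i)) (\<xi> ` W)"
    using clone_iso_image_unary_preimage[OF iso C.clone_axioms C'.sorts_disjoint n \<alpha>] by blast
  have "(\<lambda>i\<in>{1..n}. \<xi> (\<alpha> i)) \<in> {1..n} \<rightarrow>\<^sub>E cl_sort C' 1"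
    using iso \<alpha> unfolding clone_iso_def clone_hom_def by auto
  moreover have "openin (cl_part C' 1) (\<xi> ` W)"
    using om W by (auto simp: open_map_def)
  ultimately show ?thesis
    unfolding eq using C'.unary_preimage_open[OF n] by blast
qed

section \<open>Pointwise convergence in a transitive clone\<close>

text \<open>
  The subbasic sets of the topology of pointwise convergence: evaluation at a fixed tuple is a
  coordinate projection into a discrete space.
\<close>

lemma topclone_of_evaluation_open:
  assumes n: "1 \<le> n" and a: "a \<in> {1..n} \<rightarrow>\<^sub>E D" and F: "F n \<subseteq> ({1..n} \<rightarrow>\<^sub>E D) \<rightarrow>\<^sub>E D"
  shows "openin (cl_top (topclone_of D F)) ({n} \<times> {g \<in> F n. g a = b})"
proof -
  let ?P = "product_topology (\<lambda>_. discrete_topology D) ({1..n} \<rightarrow>\<^sub>E D)"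
  have P: "openin ?P {g \<in> topspace ?P. g a \<in> D \<inter> {b}}"
    using continuous_map_product_projection[OF a, of "\<lambda>_. discrete_topology D"]
    by (rule openin_continuous_map_preimage) simp
  have eq: "F n \<inter> {g \<in> topspace ?P. g a \<in> D \<inter> {b}} = {g \<in> F n. g a = b}"
    using F a by (auto simp: PiE_iff)
  have "openin (subtopology ?P (F n)) {g \<in> F n. g a = b}"
    using openin_subtopology_Int2[OF P, of "F n"] unfolding eq .
  moreover from openin_subset[OF this]
  have "{n} \<times> {g \<in> F n. g a = b} \<subseteq> Sigma {1..}
      (topspace \<circ> (\<lambda>n. subtopology (product_topology (\<lambda>_. discrete_topology D) ({1..n} \<rightarrow>\<^sub>E D)) (F n)))"
    using n by auto
  moreover have "{g. (i, g) \<in> {n} \<times> {g \<in> F n. g a = b}} = (if i = n then {g \<in> F n. g a = b} else {})" for i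
    by auto
  ultimately show ?thesis
    by (simp add: topclone_of_def openin_sum_topology)
qed

text \<open>
  A basic open set of the product topology restricts only finitely many coordinates, so agreement
  with \<open>f\<close> at these coordinates is enough to stay in it.
\<close>

lemma topclone_of_finite_evaluations:
  assumes U: "openin (cl_top (topclone_of D F)) U" and f: "(n, f) \<in> U"
    and F: "F n \<subseteq> ({1..n} \<rightarrow>\<^sub>E D) \<rightarrow>\<^sub>E D"
  obtains A where "finite A" "A \<subseteq> {1..n} \<rightarrow>\<^sub>E D"
    "\<forall>g\<in>F n. (\<forall>a\<in>A. g a = f a) \<longrightarrow> (n, g) \<in> U"
proof -
  let ?P = "product_topology (\<lambda>_. discrete_topology D) ({1..n} \<rightarrow>\<^sub>E D)"
  have "1 \<le> n" "openin (subtopology ?P (F n)) {g. (n, g) \<in> U}"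
    using U f by (auto simp: topclone_of_def openin_sum_topology)
  then obtain V where V: "openin ?P V" "{g. (n, g) \<in> U} = V \<inter> F n"
    by (auto simp: openin_subtopology)
  then have fV: "f \<in> V" using f by auto
  obtain X where X: "finite {a \<in> {1..n} \<rightarrow>\<^sub>E D. X a \<noteq> D}"
      "f \<in> Pi\<^sub>E ({1..n} \<rightarrow>\<^sub>E D) X" "Pi\<^sub>E ({1..n} \<rightarrow>\<^sub>E D) X \<subseteq> V"
    using bspec[OF V(1)[unfolded openin_product_topology_alt topspace_discrete_topology] fV]
    by (elim exE conjE) rule
  show ?thesis
  proof (rule that[OF X(1) _ ballI[OF impI]])
    fix g assume g: "g \<in> F n" "\<forall>a\<in>{a \<in> {1..n} \<rightarrow>\<^sub>E D. X a \<noteq> D}. g a = f a"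
    have gD: "g \<in> ({1..n} \<rightarrow>\<^sub>E D) \<rightarrow>\<^sub>E D" using g(1) F by blast
    have "g a \<in> X a" if "a \<in> {1..n} \<rightarrow>\<^sub>E D" for a
      using g(2) gD X(2) that by (cases "X a = D") (auto simp: PiE_iff)
    then have "g \<in> Pi\<^sub>E ({1..n} \<rightarrow>\<^sub>E D) X"
      using gD by (auto simp: PiE_iff)
    then show "(n, g) \<in> U" using X(3) V(2) g(1) by auto
  qed auto
qed

text \<open>
  A single evaluation condition on \<open>n\<close>-ary elements is a condition on the unary elements
  \<open>f(\<alpha>\<^sub>1, \<dots>, \<alpha>\<^sub>n)\<close>. As common starting point \<open>c\<close> of the \<open>\<alpha>\<^sub>i\<close> any element of the domain would do; the
  proof takes the first entry of the tuple, which exists because \<open>n \<ge> 1\<close>.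
\<close>

lemma evaluation_as_unary_preimage:
  assumes tr: "transitive_function_clone D F" and iso: "clone_iso C (topclone_of D F) \<phi>"
    and cont: "continuous_map (cl_top C) (cl_top (topclone_of D F)) \<phi>"
    and C: "topological_clone C" and n: "1 \<le> n" and a: "a \<in> {1..n} \<rightarrow>\<^sub>E D"
  obtains \<alpha> W where "\<alpha> \<in> {1..n} \<rightarrow>\<^sub>E cl_sort C 1" "openin (cl_part C 1) W"
    "unary_preimage C n \<alpha> W = {x \<in> cl_sort C n. snd (\<phi> x) a = b}"
proof -
  interpret C: topological_clone C by fact
  have F: "1 \<le> k \<Longrightarrow> F k \<subseteq> ({1..k} \<rightarrow>\<^sub>E D) \<rightarrow>\<^sub>E D" for k
    using tr unfolding transitive_function_clone_def by (intro function_clone.ops) simp_all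
  have disj: "disjoint_family_on (cl_sort (topclone_of D F)) {1..}"
    by (auto simp: disjoint_family_on_def topclone_of_def)
  define c where "c = (\<lambda>i\<in>{1..1::nat}. a 1)"
  have a1: "a 1 \<in> D" using a n by auto
  then have c: "c \<in> {1..1} \<rightarrow>\<^sub>E D" by (auto simp: c_def)
  have "\<exists>u\<in>cl_sort C 1. snd (\<phi> u) c = a i" if "i \<in> {1..n}" for i
  proof -
    have "a i \<in> D" using a that by auto
    then obtain h where "h \<in> invertible_unary D F" and hc: "h c = a i"
      using tr a1 unfolding transitive_function_clone_def c_def by blast
    then have "h \<in> F 1" by (simp add: invertible_unary_def)
    then have "(1, h) \<in> cl_sort (topclone_of D F) 1"
      by (simp add: topclone_of_def)
    then obtain u where "u \<in> cl_sort C 1" "\<phi> u = (1, h)"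
      by (rule clone_iso_surj_on_sort[OF iso disj]) simp_all
    then show ?thesis using hc by (intro bexI[of _ u]) simp_all
  qed
  then obtain \<beta> where \<beta>: "\<And>i. i \<in> {1..n} \<Longrightarrow> \<beta> i \<in> cl_sort C 1 \<and> snd (\<phi> (\<beta> i)) c = a i"
    by metis
  define \<alpha> where "\<alpha> = (\<lambda>i\<in>{1..n}. \<beta> i)"
  have \<alpha>: "\<alpha> \<in> {1..n} \<rightarrow>\<^sub>E cl_sort C 1" using \<beta> by (auto simp: \<alpha>_def)
  define W where "W = {x \<in> topspace (cl_top C). \<phi> x \<in> {1} \<times> {g \<in> F 1. g c = b}}"
  have "openin (cl_top C) W"
    unfolding W_def
    by (intro openin_continuous_map_preimage[OF cont] topclone_of_evaluation_open c F) simp_all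
  moreover have W_eq: "W = {x \<in> cl_sort C 1. snd (\<phi> x) c = b}"
  proof (intro equalityI subsetI)
    fix x assume x: "x \<in> W"
    then have "\<phi> x \<in> cl_sort (topclone_of D F) 1" "x \<in> cl_elems C"
      by (auto simp: W_def topclone_of_def C.topspace_top)
    then have "x \<in> cl_sort C 1"
      using clone_iso_reflects_sort[OF iso disj] by simp
    then show "x \<in> {x \<in> cl_sort C 1. snd (\<phi> x) c = b}"
      using x by (auto simp: W_def)
  next
    fix x assume x: "x \<in> {x \<in> cl_sort C 1. snd (\<phi> x) c = b}"
    then have "\<phi> x \<in> {1} \<times> F 1"
      using iso by (auto simp: clone_iso_def clone_hom_def topclone_of_def)
    with x show "x \<in> W"
      by (auto simp: W_def C.topspace_top cl_elems_def)
  qed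
  ultimately have W: "openin (cl_part C 1) W"
    using C.sort_open[of 1] by (auto simp: cl_part_def openin_open_subtopology)
  have "cl_comp C n 1 x \<alpha> \<in> W \<longleftrightarrow> snd (\<phi> x) a = b" if x: "x \<in> cl_sort C n" for x
  proof -
    have "\<phi> (cl_comp C n 1 x \<alpha>) = cl_comp (topclone_of D F) n 1 (\<phi> x) (\<lambda>i\<in>{1..n}. \<phi> (\<alpha> i))"
      using iso n \<alpha> x unfolding clone_iso_def clone_hom_def by auto
    then have "snd (\<phi> (cl_comp C n 1 x \<alpha>)) c = snd (\<phi> x) (\<lambda>i\<in>{1..n}. snd (\<phi> (\<alpha> i)) c)"
      using c by (simp add: topclone_of_def op_comp_def cong: restrict_cong)
    also have "(\<lambda>i\<in>{1..n}. snd (\<phi> (\<alpha> i)) c) = a"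
      using \<beta> a by (auto simp: \<alpha>_def fun_eq_iff PiE_iff extensional_def)
    finally show ?thesis
      using C.comp_closed[OF n order_refl x \<alpha>] by (simp add: W_eq)
  qed
  then have "unary_preimage C n \<alpha> W = {x \<in> cl_sort C n. snd (\<phi> x) a = b}"
    by (auto simp: unary_preimage_def)
  with \<alpha> W show ?thesis by (rule that)
qed

text \<open>
  Each of the finitely many evaluations that cut out a pointwise neighbourhood is replaced by a unary
  preimage. The resulting description mentions only compositions and open sets of unary elements,
  both of which an isomorphism that is open on the unary part carries to its target. The family
  may be empty, hence the intersection with the whole sort.
\<close>

lemma transitive_clone_unary_basis:
  assumes tr: "transitive_topological_clone TYPE('d) C"
    and U: "openin (cl_top C) U" and x: "x \<in> U" "x \<in> cl_sort C n" and n: "1 \<le> n"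
  obtains \<S> where "finite \<S>" "x \<in> cl_sort C n \<inter> \<Inter>\<S>" "cl_sort C n \<inter> \<Inter>\<S> \<subseteq> U"
    "\<And>S. S \<in> \<S> \<Longrightarrow> \<exists>\<alpha> W. \<alpha> \<in> {1..n} \<rightarrow>\<^sub>E cl_sort C 1 \<and> openin (cl_part C 1) W \<and>
      S = unary_preimage C n \<alpha> W"
proof -
  obtain D :: "'d set" and F \<phi> where C: "topological_clone C"
    and trF: "transitive_function_clone D F" and iso: "clone_iso C (topclone_of D F) \<phi>"
    and hom: "homeomorphic_map (cl_top C) (cl_top (topclone_of D F)) \<phi>"
    using tr unfolding transitive_topological_clone_def by blast
  interpret C: topological_clone C by fact
  have \<phi>_sort: "\<phi> y \<in> {n} \<times> F n" if "y \<in> cl_sort C n" for y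
    using iso n that unfolding clone_iso_def clone_hom_def by (auto simp: topclone_of_def)
  have F: "F n \<subseteq> ({1..n} \<rightarrow>\<^sub>E D) \<rightarrow>\<^sub>E D"
    using trF n unfolding transitive_function_clone_def by (intro function_clone.ops) simp_all
  have \<phi>U: "openin (cl_top (topclone_of D F)) (\<phi> ` U)"
    using homeomorphic_imp_open_map[OF hom] U by (auto simp: open_map_def)
  have \<phi>x: "(n, snd (\<phi> x)) \<in> \<phi> ` U"
    using \<phi>_sort[OF x(2)] x(1) by (intro image_eqI[of _ _ x]) auto
  obtain A where A: "finite A" "A \<subseteq> {1..n} \<rightarrow>\<^sub>E D"
      "\<forall>g\<in>F n. (\<forall>a\<in>A. g a = snd (\<phi> x) a) \<longrightarrow> (n, g) \<in> \<phi> ` U"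
    using topclone_of_finite_evaluations[OF \<phi>U \<phi>x F] .
  define S where "S a = {y \<in> cl_sort C n. snd (\<phi> y) a = snd (\<phi> x) a}" for a
  show ?thesis
  proof (rule that[of "S ` A"])
    show "finite (S ` A)" using A(1) by simp
    show "x \<in> cl_sort C n \<inter> \<Inter> (S ` A)" using x by (auto simp: S_def)
    show "cl_sort C n \<inter> \<Inter> (S ` A) \<subseteq> U"
    proof
      fix y assume y: "y \<in> cl_sort C n \<inter> \<Inter> (S ` A)"
      then have "(n, snd (\<phi> y)) \<in> \<phi> ` U"
        using \<phi>_sort[of y] by (intro A(3)[rule_format]) (auto simp: S_def)
      moreover have "\<phi> y = (n, snd (\<phi> y))"
        using \<phi>_sort[of y] y by auto
      ultimately have "\<phi> y \<in> \<phi> ` U" by simp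
      moreover have "inj_on \<phi> (cl_elems C)"
        using iso by (simp add: clone_iso_def bij_betw_def)
      moreover have "y \<in> cl_elems C" using y n by (auto simp: cl_elems_def)
      moreover have "U \<subseteq> cl_elems C" using openin_subset[OF U] by (simp add: C.topspace_top)
      ultimately show "y \<in> U" using inj_on_image_mem_iff by metis
    qed
    fix T assume "T \<in> S ` A"
    then obtain a where a: "a \<in> {1..n} \<rightarrow>\<^sub>E D" "T = S a" using A(2) by auto
    obtain \<alpha> W where "\<alpha> \<in> {1..n} \<rightarrow>\<^sub>E cl_sort C 1" "openin (cl_part C 1) W"
        "unary_preimage C n \<alpha> W = S a"
      using evaluation_as_unary_preimage[OF trF iso homeomorphic_imp_continuous_map[OF hom] C n a(1),
        where b = "snd (\<phi> x) a"]
      unfolding S_def .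
    with a(2) show "\<exists>\<alpha> W. \<alpha> \<in> {1..n} \<rightarrow>\<^sub>E cl_sort C 1 \<and> openin (cl_part C 1) W \<and>
        T = unary_preimage C n \<alpha> W"
      by blast
  qed
qed

section \<open>Openness on the unary part implies openness\<close>

theorem proposition33:
  fixes C :: "'a topclone_sig" and C' :: "'b topclone_sig" and \<xi> :: "'a \<Rightarrow> 'b"
  assumes "transitive_topological_clone TYPE('d) C"
    and "topological_clone C'"
    and "clone_iso C C' \<xi>"
    and "open_map (cl_part C 1) (cl_part C' 1) \<xi>"
  shows "open_map (cl_top C) (cl_top C') \<xi>"
  unfolding open_map_def
proof (intro allI impI)
  fix U assume U: "openin (cl_top C) U"
  have C: "topological_clone C"
    using assms(1) by (simp add: transitive_topological_clone_def)
  interpret C: topological_clone C by fact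
  interpret C': topological_clone C' by fact
  have inj: "inj_on \<xi> (cl_elems C)"
    using assms(3) by (simp add: clone_iso_def bij_betw_def)
  show "openin (cl_top C') (\<xi> ` U)"
  proof (subst openin_subopen, intro ballI)
    fix y assume "y \<in> \<xi> ` U"
    then obtain x where x: "x \<in> U" "y = \<xi> x" by auto
    then obtain n where n: "1 \<le> n" "x \<in> cl_sort C n"
      using openin_subset[OF U] by (auto simp: C.topspace_top cl_elems_def)
    obtain \<S> where \<S>: "finite \<S>" "x \<in> cl_sort C n \<inter> \<Inter>\<S>" "cl_sort C n \<inter> \<Inter>\<S> \<subseteq> U"
        "\<And>S. S \<in> \<S> \<Longrightarrow> \<exists>\<alpha> W. \<alpha> \<in> {1..n} \<rightarrow>\<^sub>E cl_sort C 1 \<and> openin (cl_part C 1) W \<and>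
          S = unary_preimage C n \<alpha> W"
      using transitive_clone_unary_basis[OF assms(1) U x(1) n(2,1)] by blast
    \<comment> \<open>Injectivity of \<open>\<xi>\<close> lets the image commute with the finite intersection.\<close>
    let ?T = "cl_sort C' n \<inter> \<Inter>((`) \<xi> ` \<S>)"
    have "openin (cl_top C') (\<xi> ` S)" if "S \<in> \<S>" for S
      using \<S>(4)[OF that] clone_iso_image_unary_preimage_open[OF assms(3) C assms(2,4) n(1)]
      by auto
    then have "openin (cl_top C') ?T"
      using \<S>(1) C'.sort_open[OF n(1)] by (intro openin_Int_Inter) auto
    moreover have "y \<in> ?T"
      using assms(3) n x(2) \<S>(2) unfolding clone_iso_def clone_hom_def by auto
    moreover have "?T \<subseteq> \<xi> ` U"
    proof
      fix z assume z: "z \<in> ?T"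
      then obtain u where u: "u \<in> cl_sort C n" "\<xi> u = z"
        using clone_iso_surj_on_sort[OF assms(3) C'.sorts_disjoint _ n(1)] by blast
      have "u \<in> S" if S: "S \<in> \<S>" for S
      proof -
        have "S \<subseteq> cl_elems C"
          using \<S>(4)[OF S] n(1) by (auto simp: unary_preimage_def cl_elems_def)
        moreover have "u \<in> cl_elems C" using u n(1) by (auto simp: cl_elems_def)
        moreover have "\<xi> u \<in> \<xi> ` S" using z u(2) S by auto
        ultimately show ?thesis using inj_on_image_mem_iff[OF inj] by metis
      qed
      then show "z \<in> \<xi> ` U" using u \<S>(3) by auto
    qed
    ultimately show "\<exists>T. openin (cl_top C') T \<and> y \<in> T \<and> T \<subseteq> \<xi> ` U" by blast
  qed
qed

end
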